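(* Let $y\in\mathbb{R}$, $b>0$, $\gamma^{(0)}>0$, and let $(\gamma^{(k)})_{k\ge0}$ be generated by the one-dimensional EM algorithm $$\gamma^{(k+1)}=y^2\Big(\frac{\gamma^{(k)}}{b+\gamma^{(k)}}\Big)^2+\frac{b\,\gamma^{(k)}}{b+\gamma^{(k)}},\qquad k\ge0.$$ (i) If $y^2\ge b$, then $\gamma^{(k)}$ converges to $\gamma^*=y^2-b$ with order of convergence $p=1$ and rate of convergence $\zeta=\frac{b(2y^2-b)}{y^4}$. (ii) If $y^2<b$, then $\gamma^{(k)}$ converges to $\gamma^*=0$ with order of convergence $p=1$ and rate of convergence $\zeta=1$. Moreover, $$\frac{b}{k+b/\gamma^{(0)}}\le\gamma^{(k)}\le\frac{c_0}{k+c_0/\gamma^{(0)}},\qquad k\ge0,$$ where $c_0=y^2+b+\frac{b^2}{b-y^2}$; that is, $\gamma^{(k)}$ converges to $\gamma^*=0$ in the rate of $O(1/k)$.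
   Context: A sequence $\{\gamma^{(k)}\}$ converges to $\gamma^*$ with order of convergence $p$ and rate of convergence $\zeta$ if $\gamma^{(k)}\to\gamma^*$ and $\lim_{k\to\infty}\frac{|\gamma^{(k+1)}-\gamma^*|}{|\gamma^{(k)}-\gamma^*|^p}=\zeta$. The assertion on this limit is understood for sequences with $\gamma^{(k)}\ne\gamma^*$ for all $k$ (so that the quotients are defined); the convergence $\gamma^{(k)}\to\gamma^*$ is asserted in all cases. *)

theory Defs
  imports Complex_Main "HOL-Library.Landau_Symbols"
begin

text \<open>In \<open>HOL\<close> a quotient with denominator 0 is 0, so this notion is meaningful only for sequences
  that never hit their limit, i.e. with \<open>\<gamma> k \<noteq> L\<close> for all \<open>k\<close>.\<close>

definition converges_with_order_rate :: "(nat \<Rightarrow> real) \<Rightarrow> real \<Rightarrow> real \<Rightarrow> real \<Rightarrow> bool" where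
  "converges_with_order_rate \<gamma> L p \<zeta> \<longleftrightarrow>
     \<gamma> \<longlonglongrightarrow> L \<and>
     (\<lambda>k. \<bar>\<gamma> (Suc k) - L\<bar> / \<bar>\<gamma> k - L\<bar> powr p) \<longlonglongrightarrow> \<zeta>"

definition em_step :: "real \<Rightarrow> real \<Rightarrow> real \<Rightarrow> real" where
  "em_step y b g = y\<^sup>2 * (g / (b + g))\<^sup>2 + b * g / (b + g)"

end

theory Submission
  imports Defs
begin

text \<open>
  Write \<open>L = y\<^sup>2 - b\<close> and \<open>F = em_step y b\<close>. Everything rests on the factorisation
  \<open>F g - L = q g * (g - L)\<close> with \<open>q g = b * (b + 2 * g) / (b + g)\<^sup>2 \<in> (0, 1]\<close>: the error keeps its sign and
  shrinks, so the iterates are monotone and converge to a fixed point, and the rate is \<open>q L\<close>.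
  If \<open>y\<^sup>2 < b\<close>, each step increases \<open>1 / \<gamma>\<close> by an amount between \<open>1 / c0\<close> and \<open>1 / b\<close>.
\<close>

text \<open>This is \<open>q\<close> from above. For \<open>b + g \<noteq> 0\<close> it equals
  \<open>1 - (g / (b + g))\<^sup>2\<close>, so for \<open>b > 0\<close> and \<open>g \<ge> 0\<close>
  it lies in \<open>(0, 1]\<close> and takes the value \<open>1\<close> only at
  \<open>g = 0\<close>.\<close>

definition em_factor :: "real \<Rightarrow> real \<Rightarrow> real" where
  "em_factor b g = b * (b + 2 * g) / (b + g)\<^sup>2"

lemma em_step_error:
  assumes "b + g \<noteq> 0"
  shows "em_step y b g - (y\<^sup>2 - b) = em_factor b g * (g - (y\<^sup>2 - b))"
  using assms unfolding em_step_def em_factor_def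
  by (simp add: power2_eq_square divide_simps) (simp add: algebra_simps)

text \<open>Counterpart of \<open>em_step_error\<close> at the other fixed point \<open>0\<close>.
  For \<open>b > 0\<close> the factor in front of \<open>g\<close> tends to \<open>1\<close> as
  \<open>g\<close> tends to \<open>0\<close>, which is the source of the rate
  \<open>1\<close>.\<close>

lemma em_step_eq_mult:
  assumes "b + g \<noteq> 0"
  shows "em_step y b g = ((y\<^sup>2 + b) * g + b\<^sup>2) / (b + g)\<^sup>2 * g"
  using assms unfolding em_step_def
  by (simp add: power2_eq_square divide_simps) (simp add: algebra_simps)

lemma em_factor_pos:
  assumes "b > 0" "g \<ge> 0"
  shows "em_factor b g > 0"
  using assms by (simp add: em_factor_def add_pos_nonneg)

lemma em_factor_le_1:
  assumes "b > 0" "g \<ge> 0"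
  shows "em_factor b g \<le> 1"
  using assms by (simp add: em_factor_def add_pos_nonneg divide_le_eq)
    (simp add: power2_eq_square algebra_simps)

lemma em_factor_eq_1D:
  assumes "b > 0" "g \<ge> 0" "em_factor b g = 1"
  shows "g = 0"
proof -
  have "b * (b + 2 * g) = (b + g)\<^sup>2"
    using assms by (simp add: em_factor_def divide_eq_eq split: if_splits)
  then show ?thesis by (simp add: power2_eq_square algebra_simps)
qed

lemma tendsto_em_factor:
  assumes "(f \<longlongrightarrow> l) F" "b + l \<noteq> 0"
  shows "((\<lambda>x. em_factor b (f x)) \<longlongrightarrow> em_factor b l) F"
  unfolding em_factor_def using assms by (intro tendsto_intros) auto

lemma em_step_pos:
  assumes "b > 0" "g > 0"
  shows "em_step y b g > 0"
  using assms by (simp add: em_step_def add_nonneg_pos)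

text \<open>Dropping the nonnegative square from the step leaves \<open>b * g / (b + g)\<close>,
  whose reciprocal is exactly \<open>1 / g + 1 / b\<close>.\<close>

lemma em_step_inverse_le:
  assumes "b > 0" "g > 0"
  shows "1 / em_step y b g \<le> 1 / g + 1 / b"
proof -
  have "b * g / (b + g) \<le> em_step y b g" by (simp add: em_step_def)
  then have "1 / em_step y b g \<le> 1 / (b * g / (b + g))"
    using assms em_step_pos[OF assms] by (intro divide_left_mono) auto
  also have "\<dots> = 1 / g + 1 / b" using assms by (simp add: field_simps)
  finally show ?thesis .
qed

text \<open>The step is compared with the map sending \<open>g\<close> to
  \<open>c * g / (c + g)\<close>, which adds exactly \<open>1 / c\<close> to the reciprocal.\<close>

lemma em_step_inverse_ge:
  assumes "b > 0" "g > 0" and c: "c \<ge> y\<^sup>2 + b" "c * (b - y\<^sup>2) \<ge> b\<^sup>2"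
  shows "1 / em_step y b g \<ge> 1 / g + 1 / c"
proof -
  have "c > 0" using c(1) assms(1) by (smt (verit) zero_le_power2)
  \<comment> \<open>The terms free of \<open>g\<close> cancel, and the two conditions on
    \<open>c\<close> say that the remaining coefficients are nonnegative.\<close>
  have "c * (b + g)\<^sup>2 - ((y\<^sup>2 + b) * g + b\<^sup>2) * (c + g)
      = (c - (y\<^sup>2 + b)) * g\<^sup>2 + (c * (b - y\<^sup>2) - b\<^sup>2) * g"
    by (simp add: power2_eq_square algebra_simps)
  also have "\<dots> \<ge> 0" using assms by simp
  finally have "((y\<^sup>2 + b) * g + b\<^sup>2) * (c + g) \<le> c * (b + g)\<^sup>2" by simp
  then have "((y\<^sup>2 + b) * g + b\<^sup>2) / (b + g)\<^sup>2 \<le> c / (c + g)"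
    using assms \<open>c > 0\<close> by (simp add: frac_le_eq divide_le_0_iff field_simps)
  then have "em_step y b g \<le> c / (c + g) * g"
    using assms em_step_eq_mult[of b g y] by (simp add: mult_right_mono del: times_divide_eq_left)
  then have "1 / em_step y b g \<ge> 1 / (c / (c + g) * g)"
    using assms \<open>c > 0\<close> em_step_pos[of b g y] by (intro divide_left_mono) auto
  also have "1 / (c / (c + g) * g) = 1 / g + 1 / c"
    using assms \<open>c > 0\<close> by (simp add: field_simps)
  finally show ?thesis .
qed

locale em_iteration =
  fixes y b :: real and \<gamma> :: "nat \<Rightarrow> real"
  assumes b_pos: "b > 0"
    and init_pos: "\<gamma> 0 > 0"
    and step: "\<gamma> (Suc k) = em_step y b (\<gamma> k)"
begin

lemma pos: "\<gamma> k > 0"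
  by (induction k) (use init_pos b_pos step em_step_pos in auto)

lemma error_step: "\<gamma> (Suc k) - (y\<^sup>2 - b) = em_factor b (\<gamma> k) * (\<gamma> k - (y\<^sup>2 - b))"
  using em_step_error[of b "\<gamma> k" y] pos[of k] b_pos by (simp add: step)

lemma factor_bounds: "0 < em_factor b (\<gamma> k)" "em_factor b (\<gamma> k) \<le> 1"
  using em_factor_pos em_factor_le_1 b_pos pos[of k] by (auto simp: less_imp_le)

lemma decreasing_above:
  assumes "\<gamma> 0 \<ge> y\<^sup>2 - b"
  shows "\<gamma> k \<ge> y\<^sup>2 - b" "\<gamma> (Suc k) \<le> \<gamma> k"
proof -
  have above: "\<gamma> k \<ge> y\<^sup>2 - b" for k
  proof (induction k)
    case (Suc k)
    have "0 \<le> em_factor b (\<gamma> k) * (\<gamma> k - (y\<^sup>2 - b))"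
      using Suc factor_bounds(1)[of k] by (intro mult_nonneg_nonneg) auto
    then show ?case using error_step[of k] by simp
  qed (use assms in simp)
  show "\<gamma> k \<ge> y\<^sup>2 - b" by (rule above)
  show "\<gamma> (Suc k) \<le> \<gamma> k"
    using error_step[of k] mult_left_le_one_le[of "\<gamma> k - (y\<^sup>2 - b)" "em_factor b (\<gamma> k)"]
      factor_bounds[of k] above[of k] by simp
qed

lemma increasing_below:
  assumes "\<gamma> 0 \<le> y\<^sup>2 - b"
  shows "\<gamma> k \<le> y\<^sup>2 - b" "\<gamma> k \<le> \<gamma> (Suc k)"
proof -
  have below: "\<gamma> k \<le> y\<^sup>2 - b" for k
  proof (induction k)
    case (Suc k)
    have "em_factor b (\<gamma> k) * (\<gamma> k - (y\<^sup>2 - b)) \<le> 0"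
      using Suc factor_bounds(1)[of k] by (intro mult_nonneg_nonpos) auto
    then show ?case using error_step[of k] by simp
  qed (use assms in simp)
  show "\<gamma> k \<le> y\<^sup>2 - b" by (rule below)
  show "\<gamma> k \<le> \<gamma> (Suc k)"
    using error_step[of k] mult_left_le_one_le[of "(y\<^sup>2 - b) - \<gamma> k" "em_factor b (\<gamma> k)"]
      factor_bounds[of k] below[of k] by (simp add: algebra_simps)
qed

text \<open>Passing to the limit in the error recursion leaves two options: the limiting error is
  zero, or the factor is \<open>1\<close> at \<open>l\<close>, which forces
  \<open>l = 0\<close>.\<close>

lemma limit_is_fixed_point:
  assumes lim: "\<gamma> \<longlonglongrightarrow> l"
  shows "l = 0 \<or> l = y\<^sup>2 - b"
proof -
  have "l \<ge> 0" by (rule LIMSEQ_le_const[OF lim]) (use pos in \<open>auto simp: less_imp_le\<close>)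
  then have "(\<lambda>k. em_factor b (\<gamma> k) * (\<gamma> k - (y\<^sup>2 - b))) \<longlonglongrightarrow> em_factor b l * (l - (y\<^sup>2 - b))"
    using b_pos by (intro tendsto_intros tendsto_em_factor lim) auto
  moreover have "(\<lambda>k. \<gamma> (Suc k) - (y\<^sup>2 - b)) \<longlonglongrightarrow> l - (y\<^sup>2 - b)"
    using LIMSEQ_Suc[OF lim] by (intro tendsto_intros)
  ultimately have "em_factor b l * (l - (y\<^sup>2 - b)) = l - (y\<^sup>2 - b)"
    unfolding error_step by (rule LIMSEQ_unique)
  then show ?thesis using em_factor_eq_1D[OF b_pos \<open>l \<ge> 0\<close>] by auto
qed

lemma tendsto_large:
  assumes "y\<^sup>2 \<ge> b"
  shows "\<gamma> \<longlonglongrightarrow> y\<^sup>2 - b"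
proof (cases "\<gamma> 0 \<ge> y\<^sup>2 - b")
  case True
  have dec: "decseq \<gamma>" using decreasing_above[OF True] by (intro decseq_SucI)
  obtain l where l: "\<gamma> \<longlonglongrightarrow> l"
    using decseq_convergent[OF dec] decreasing_above(1)[OF True] by blast
  have "l \<ge> y\<^sup>2 - b" by (rule LIMSEQ_le_const[OF l]) (use decreasing_above(1)[OF True] in auto)
  \<comment> \<open>If \<open>l = 0\<close>, then \<open>0 \<ge> y\<^sup>2 - b \<ge> 0\<close>, so
    both candidates coincide.\<close>
  then have "l = y\<^sup>2 - b" using limit_is_fixed_point[OF l] assms by auto
  then show ?thesis using l by simp
next
  case False
  then have le: "\<gamma> 0 \<le> y\<^sup>2 - b" by simp
  have inc: "incseq \<gamma>" using increasing_below[OF le] by (intro incseq_SucI)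
  obtain l where l: "\<gamma> \<longlonglongrightarrow> l"
    using incseq_convergent[OF inc] increasing_below(1)[OF le] by blast
  have "\<gamma> 0 \<le> l" using incseq_le[OF inc l] .
  \<comment> \<open>An increasing sequence with a positive start cannot tend to
    \<open>0\<close>.\<close>
  then have "l = y\<^sup>2 - b" using limit_is_fixed_point[OF l] init_pos by auto
  then show ?thesis using l by simp
qed

text \<open>The error quotient is exactly \<open>em_factor b (\<gamma> k)\<close>, so the rate is
  the value of this continuous function at the limit, where
  \<open>b + (y\<^sup>2 - b) = y\<^sup>2\<close> turns the denominator into
  \<open>y ^ 4\<close>.\<close>

lemma rate_large:
  assumes "y\<^sup>2 \<ge> b" and ne: "\<And>k. \<gamma> k \<noteq> y\<^sup>2 - b"
  shows "converges_with_order_rate \<gamma> (y\<^sup>2 - b) 1 (b * (2 * y\<^sup>2 - b) / y ^ 4)"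
proof -
  have "\<bar>\<gamma> (Suc k) - (y\<^sup>2 - b)\<bar> / \<bar>\<gamma> k - (y\<^sup>2 - b)\<bar> powr 1 = em_factor b (\<gamma> k)" for k
    using ne[of k] factor_bounds(1)[of k] by (simp add: error_step abs_mult)
  moreover have "(\<lambda>k. em_factor b (\<gamma> k)) \<longlonglongrightarrow> em_factor b (y\<^sup>2 - b)"
    using tendsto_large[OF assms(1)] assms(1) b_pos by (intro tendsto_em_factor) auto
  moreover have "em_factor b (y\<^sup>2 - b) = b * (2 * y\<^sup>2 - b) / y ^ 4"
    by (simp add: em_factor_def algebra_simps flip: power_mult)
  ultimately show ?thesis
    using tendsto_large[OF assms(1)] by (simp add: converges_with_order_rate_def)
qed

text \<open>Each step adds at most \<open>1 / b\<close> to the reciprocal; summing over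
  \<open>k\<close> steps and inverting gives the bound.\<close>

lemma lower_bound: "b / (real k + b / \<gamma> 0) \<le> \<gamma> k"
proof -
  have "1 / \<gamma> k \<le> real k / b + 1 / \<gamma> 0"
  proof (induction k)
    case (Suc k)
    then show ?case
      using em_step_inverse_le[OF b_pos pos, of y k] by (simp add: step add_divide_distrib)
  qed simp
  also have "\<dots> = (real k + b / \<gamma> 0) / b" using b_pos by (simp add: field_simps)
  finally show ?thesis
    using pos[of k] b_pos init_pos add_nonneg_pos[of "real k" "b / \<gamma> 0"]
    by (simp add: divide_simps mult.commute)
qed

text \<open>Dual to \<open>lower_bound\<close>: each step adds at least \<open>1 / c\<close> to the
  reciprocal.\<close>

lemma upper_bound:
  assumes c: "c \<ge> y\<^sup>2 + b" "c * (b - y\<^sup>2) \<ge> b\<^sup>2"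
  shows "\<gamma> k \<le> c / (real k + c / \<gamma> 0)"
proof -
  have "c > 0" using c(1) b_pos by (smt (verit) zero_le_power2)
  have "1 / \<gamma> k \<ge> real k / c + 1 / \<gamma> 0"
  proof (induction k)
    case (Suc k)
    then show ?case
      using em_step_inverse_ge[OF b_pos pos c, of k] by (simp add: step add_divide_distrib)
  qed simp
  also have "real k / c + 1 / \<gamma> 0 = (real k + c / \<gamma> 0) / c"
    using \<open>c > 0\<close> by (simp add: field_simps)
  finally show ?thesis
    using pos[of k] \<open>c > 0\<close> init_pos add_nonneg_pos[of "real k" "c / \<gamma> 0"]
    by (simp add: divide_simps mult.commute)
qed

lemma upper_bound_bigo:
  assumes "c > 0" and bound: "\<And>k. \<gamma> k \<le> c / (real k + c / \<gamma> 0)"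
  shows "\<gamma> \<in> O(\<lambda>k. 1 / real k)"
proof (rule bigoI)
  show "\<forall>\<^sub>F k in sequentially. norm (\<gamma> k) \<le> c * norm (1 / real k)"
    \<comment> \<open>At \<open>k = 0\<close> the comparison function \<open>1 / real k\<close> is
      \<open>0\<close> in HOL, so the estimate is claimed only for \<open>k > 0\<close>.\<close>
    using eventually_gt_at_top[of 0]
  proof eventually_elim
    case (elim k)
    have "c / (real k + c / \<gamma> 0) \<le> c / real k"
      using elim assms(1) init_pos by (intro divide_left_mono) (auto intro!: mult_pos_pos add_pos_pos)
    then show ?case using bound[of k] pos[of k] by simp
  qed
qed

text \<open>The quotient is the factor from \<open>em_step_eq_mult\<close>, with limit
  \<open>b\<^sup>2 / b\<^sup>2 = 1\<close>. The factor \<open>em_factor\<close> does not serve here,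
  since it measures errors relative to \<open>y\<^sup>2 - b\<close>.\<close>

lemma rate_zero:
  assumes lim: "\<gamma> \<longlonglongrightarrow> 0"
  shows "converges_with_order_rate \<gamma> 0 1 1"
proof -
  have "\<bar>\<gamma> (Suc k) - 0\<bar> / \<bar>\<gamma> k - 0\<bar> powr 1 = ((y\<^sup>2 + b) * \<gamma> k + b\<^sup>2) / (b + \<gamma> k)\<^sup>2" for k
    using pos[of k] pos[of "Suc k"] b_pos em_step_eq_mult[of b "\<gamma> k" y] by (simp add: step)
  moreover have "(\<lambda>k. ((y\<^sup>2 + b) * \<gamma> k + b\<^sup>2) / (b + \<gamma> k)\<^sup>2)
      \<longlonglongrightarrow> ((y\<^sup>2 + b) * 0 + b\<^sup>2) / (b + 0)\<^sup>2"
    using b_pos by (intro tendsto_intros lim) auto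
  ultimately show ?thesis using lim b_pos by (simp add: converges_with_order_rate_def)
qed

end

theorem proposition4p1:
  fixes y b :: real and \<gamma> :: "nat \<Rightarrow> real"
  assumes "b > 0"
    and "\<gamma> 0 > 0"
    and "\<And>k. \<gamma> (Suc k) = em_step y b (\<gamma> k)"
  shows "(y\<^sup>2 \<ge> b \<longrightarrow>
            \<gamma> \<longlonglongrightarrow> y\<^sup>2 - b \<and>
            ((\<forall>k. \<gamma> k \<noteq> y\<^sup>2 - b) \<longrightarrow>
               converges_with_order_rate \<gamma> (y\<^sup>2 - b) 1 (b * (2 * y\<^sup>2 - b) / y ^ 4))) \<and>
         (y\<^sup>2 < b \<longrightarrow>
            (\<forall>k. \<gamma> k \<noteq> 0) \<and>
            converges_with_order_rate \<gamma> 0 1 1 \<and>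
            (let c0 = y\<^sup>2 + b + b\<^sup>2 / (b - y\<^sup>2) in
               \<forall>k. b / (real k + b / \<gamma> 0) \<le> \<gamma> k \<and> \<gamma> k \<le> c0 / (real k + c0 / \<gamma> 0)) \<and>
            \<gamma> \<in> O(\<lambda>k. 1 / real k))"
proof -
  interpret em_iteration y b \<gamma> by unfold_locales (use assms in auto)
  have small: "(\<forall>k. \<gamma> k \<noteq> 0) \<and> converges_with_order_rate \<gamma> 0 1 1 \<and>
      (let c0 = y\<^sup>2 + b + b\<^sup>2 / (b - y\<^sup>2) in
         \<forall>k. b / (real k + b / \<gamma> 0) \<le> \<gamma> k \<and> \<gamma> k \<le> c0 / (real k + c0 / \<gamma> 0)) \<and>
      \<gamma> \<in> O(\<lambda>k. 1 / real k)" if "y\<^sup>2 < b"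
  proof -
    \<comment> \<open>The conditions of \<open>upper_bound\<close> ask for
      \<open>c \<ge> y\<^sup>2 + b\<close> and \<open>c \<ge> b\<^sup>2 / (b - y\<^sup>2)\<close>;
      \<open>c0\<close> is the sum of these two nonnegative thresholds and so meets both.\<close>
    define c0 where "c0 = y\<^sup>2 + b + b\<^sup>2 / (b - y\<^sup>2)"
    have c0: "c0 \<ge> y\<^sup>2 + b" using that by (simp add: c0_def)
    have "c0 * (b - y\<^sup>2) = (y\<^sup>2 + b) * (b - y\<^sup>2) + b\<^sup>2"
      using that by (simp add: c0_def distrib_right)
    also have "\<dots> \<ge> b\<^sup>2" using that b_pos by simp
    finally have upper: "\<gamma> k \<le> c0 / (real k + c0 / \<gamma> 0)" for k
      using upper_bound[OF c0] by simp
    have "c0 > 0" using c0 b_pos by (smt (verit) zero_le_power2)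
    then have bigo: "\<gamma> \<in> O(\<lambda>k. 1 / real k)" using upper by (rule upper_bound_bigo)
    \<comment> \<open>In this case convergence to \<open>0\<close> is read off from the decay bound
      instead of from monotonicity.\<close>
    have "(\<lambda>k. 1 / real k) \<in> o(\<lambda>_. 1)"
      by (rule smalloI_tendsto) (use lim_1_over_n in auto)
    then have "\<gamma> \<in> o(\<lambda>_. 1)" by (rule landau_o.big_small_trans[OF bigo])
    then have "\<gamma> \<longlonglongrightarrow> 0" using smalloD_tendsto by fastforce
    then show ?thesis
      using rate_zero lower_bound upper bigo pos by (simp add: Let_def c0_def less_imp_neq[symmetric])
  qed
  show ?thesis using tendsto_large rate_large small by blast
qed

end
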